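(* For any $X\in L^1$, there exist a sequence $(\pi_n)_{n\in\mathbb{N}}\subset\Pi$ and $k\in\mathbb{R}_+$ such that $$\mathbb{E}[X|\pi_n]\to X\ \text{ almost surely, and }\ |\mathbb{E}[X|\pi_n]|\le|X|+k\ \text{ a.s. for all } n\in\mathbb{N}.$$
   Context: $(\Omega,\mathcal{F},\mathbb{P})$ is a fixed nonatomic probability space and $L^1$ is the space of integrable random variables modulo a.s. equality. $\Pi$ is the collection of all finite measurable partitions of $\Omega$ whose members have nonzero probability, and $\mathbb{E}[X|\pi]:=\mathbb{E}[X|\sigma(\pi)]$ for $\pi\in\Pi$, where $\sigma(\pi)$ is the $\sigma$-algebra generated by $\pi$. *)

theory Defs
  imports "HOL-Probability.Probability"
begin

definition nonatomic :: "'a measure \<Rightarrow> bool" where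
  "nonatomic M \<longleftrightarrow>
     (\<forall>A \<in> sets M. emeasure M A > 0 \<longrightarrow>
        (\<exists>B \<in> sets M. B \<subseteq> A \<and> 0 < emeasure M B \<and> emeasure M B < emeasure M A))"

definition finite_partitions :: "'a measure \<Rightarrow> 'a set set set" where
  "finite_partitions M =
     {P. finite P \<and> partition_on (space M) P \<and> P \<subseteq> sets M \<and> (\<forall>A \<in> P. emeasure M A \<noteq> 0)}"

text \<open>
  The next fact ensures that \<open>real_cond_exp M (sigma (space M) P)\<close> is the genuine conditional
  expectation for \<open>P \<in> finite_partitions M\<close>: the library function is a dummy value when its second
  argument is not a subalgebra.
\<close>

lemma subalgebra_sigma_partition:
  assumes "P \<in> finite_partitions M"
  shows "subalgebra M (sigma (space M) P)"
proof -
  have "P \<subseteq> sets M" using assms by (simp add: finite_partitions_def)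
  moreover from this have "P \<subseteq> Pow (space M)" using sets.space_closed by blast
  ultimately show ?thesis
    by (simp add: subalgebra_def sets.sigma_sets_subset)
qed

end

theory Submission
  imports Defs
begin

text \<open>
  Cut \<open>\<Omega>\<close> into the sets where \<open>X\<close> lies in a given interval of a fine grid and \<open>\<bar>X\<bar> \<le> c\<close>.
  The tail \<open>{\<bar>X\<bar> > c}\<close> cannot be a cell of its own, because the mean of \<open>X\<close> over it need not be
  dominated by \<open>\<bar>X\<bar> + k\<close>. Instead it is merged with one cell of positive probability that
  meets \<open>{\<bar>X\<bar> \<le> K}\<close>, where \<open>K\<close> is independent of the grid. Once that cell is fixed, \<open>c\<close> is taken
  so large that the tail barely changes its mean, which is therefore bounded by about \<open>K\<close> and still
  close to \<open>X\<close> on the original cell. Null cells are merged in as well.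
\<close>

text \<open>Containing or missing a fixed cell is preserved by complements and countable unions, and
  the cells have it by disjointness. It makes every function measurable for
  \<open>sigma \<Omega> P\<close> constant on cells.\<close>

lemma sigma_sets_partition_saturated:
  assumes "partition_on \<Omega> P" "A \<in> P" "B \<in> sigma_sets \<Omega> P"
  shows "A \<subseteq> B \<or> A \<inter> B = {}"
  using assms(3)
proof induction
  case (Basic B)
  then show ?case
    using assms(1,2) by (auto simp: partition_on_def disjoint_def)
next
  case (Compl B)
  moreover have "A \<subseteq> \<Omega>"
    using assms(1,2) by (auto simp: partition_on_def)
  ultimately show ?case by blast
qed blast+

context prob_space
begin

text \<open>The formula holds at every point of the cell, not just almost everywhere: any measurable
  version is constant on a cell, and integrating over that cell, which has positive measure,
  determines the constant.\<close>

lemma real_cond_exp_finite_partition: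
  fixes X :: "'a \<Rightarrow> real"
  assumes P: "P \<in> finite_partitions M" and X: "integrable M X"
    and A: "A \<in> P" and \<omega>: "\<omega> \<in> A"
  shows "real_cond_exp M (sigma (space M) P) X \<omega> = (\<integral>x\<in>A. X x \<partial>M) / prob A"
proof -
  let ?F = "sigma (space M) P"
  let ?Y = "real_cond_exp M ?F X"
  interpret finite_measure_subalgebra M ?F
    by unfold_locales (rule subalgebra_sigma_partition[OF P])
  have part: "partition_on (space M) P" and sub: "P \<subseteq> sets M" and nz: "emeasure M A \<noteq> 0"
    using P A by (auto simp: finite_partitions_def)
  have Pow: "P \<subseteq> Pow (space M)"
    using sub sets.space_closed by blast
  have setsF: "sets ?F = sigma_sets (space M) P" and spF: "space ?F = space M"
    using Pow by simp_all
  have AM: "A \<in> sets M" and AF: "A \<in> sets ?F"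
    using A sub setsF by auto
  have const: "?Y x = ?Y \<omega>" if "x \<in> A" for x
  proof -
    \<comment> \<open>This level set meets \<open>A\<close> in \<open>\<omega>\<close>, so
      saturation forces it to contain all of \<open>A\<close>.\<close>
    have "{y \<in> space ?F. ?Y y = ?Y \<omega>} \<in> sets ?F"
      by measurable
    then have "A \<subseteq> {y \<in> space ?F. ?Y y = ?Y \<omega>} \<or> A \<inter> {y \<in> space ?F. ?Y y = ?Y \<omega>} = {}"
      using sigma_sets_partition_saturated[OF part A] setsF by simp
    then show ?thesis
      using \<omega> that Pow A spF by auto
  qed
  have "(\<integral>x\<in>A. X x \<partial>M) = (\<integral>x\<in>A. ?Y x \<partial>M)"
    by (rule real_cond_exp_intA[OF X AF])
  also have "\<dots> = (\<integral>x\<in>A. ?Y \<omega> \<partial>M)"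
    using const by (intro set_lebesgue_integral_cong[OF AM]) auto
  also have "\<dots> = ?Y \<omega> * prob A"
    using AM by (simp add: set_lebesgue_integral_def)
  finally show ?thesis
    using nz AM by (simp add: emeasure_eq_measure)
qed

text \<open>Dominated convergence with majorant |X|: at each point the truncated integrand is
  eventually zero.\<close>

lemma tail_integral_small:
  fixes X :: "'a \<Rightarrow> real"
  assumes X: "integrable M X" and "\<epsilon> > 0"
  shows "\<exists>c\<ge>b. (\<integral>x. \<bar>X x\<bar> * indicator {x. c < \<bar>X x\<bar>} x \<partial>M) < \<epsilon>"
proof -
  have "(\<lambda>n. \<integral>x. \<bar>X x\<bar> * indicator {x. real n < \<bar>X x\<bar>} x \<partial>M) \<longlonglongrightarrow> (\<integral>x. 0 \<partial>M)"
  proof (rule integral_dominated_convergence[where w = "\<lambda>x. \<bar>X x\<bar>"])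
    show "AE x in M. (\<lambda>n. \<bar>X x\<bar> * indicator {x. real n < \<bar>X x\<bar>} x) \<longlonglongrightarrow> 0"
    proof (rule AE_I2)
      fix x
      have "\<forall>\<^sub>F n in sequentially. \<bar>X x\<bar> \<le> real n"
        by (rule eventually_sequentiallyI[of "nat \<lceil>\<bar>X x\<bar>\<rceil>"]) linarith
      then have "\<forall>\<^sub>F n in sequentially. \<bar>X x\<bar> * indicator {x. real n < \<bar>X x\<bar>} x = 0"
        by eventually_elim auto
      then show "(\<lambda>n. \<bar>X x\<bar> * indicator {x. real n < \<bar>X x\<bar>} x) \<longlonglongrightarrow> 0"
        by (rule tendsto_eventually)
    qed
  qed (use X in \<open>auto split: split_indicator\<close>)
  then have "\<forall>\<^sub>F n in sequentially. (\<integral>x. \<bar>X x\<bar> * indicator {x. real n < \<bar>X x\<bar>} x \<partial>M) < \<epsilon>"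
    using \<open>\<epsilon> > 0\<close> by (auto intro: order_tendstoD)
  moreover have "\<forall>\<^sub>F n in sequentially. b \<le> real n"
    by (rule eventually_sequentiallyI[of "nat \<lceil>b\<rceil>"]) linarith
  ultimately have "\<forall>\<^sub>F n in sequentially. b \<le> real n \<and>
      (\<integral>x. \<bar>X x\<bar> * indicator {x. real n < \<bar>X x\<bar>} x \<partial>M) < \<epsilon>"
    by eventually_elim auto
  then show ?thesis
    using eventually_happens'[OF sequentially_bot] by blast
qed

text \<open>The domination constant involves \<open>K\<close> and \<open>e\<close> but not
  \<open>b\<close>, so a single \<open>k\<close> survives when \<open>e\<close> tends to 0 and
  \<open>b\<close> to infinity.\<close>

lemma finite_partition_approx:
  fixes X :: "'a \<Rightarrow> real"
  assumes X: "integrable M X" and e: "e > 0"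
    and K: "prob {\<omega> \<in> space M. \<bar>X \<omega>\<bar> \<le> K} > 0"
  shows "\<exists>\<pi>\<in>finite_partitions M.
    AE \<omega> in M. (\<bar>X \<omega>\<bar> \<le> b \<longrightarrow> \<bar>real_cond_exp M (sigma (space M) \<pi>) X \<omega> - X \<omega>\<bar> \<le> 2 * e) \<and>
      \<bar>real_cond_exp M (sigma (space M) \<pi>) X \<omega>\<bar> \<le> \<bar>X \<omega>\<bar> + K + 2 * e"
proof -
  have [measurable]: "X \<in> borel_measurable M"
    using X by simp
  define g where "g \<omega> = \<lfloor>X \<omega> / e\<rfloor>" for \<omega>
  have [measurable]: "g \<in> measurable M (count_space UNIV)"
    unfolding g_def by measurable
  \<comment> \<open>The level stays a parameter: level \<open>K\<close> selects the cell that
    receives the tail, and a larger level \<open>c\<close> yields the partition.\<close>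
  define D where "D c i = {\<omega> \<in> space M. g \<omega> = i \<and> \<bar>X \<omega>\<bar> \<le> c}" for c i
  have D_sets[measurable]: "D c i \<in> sets M" for c i
    unfolding D_def by measurable
  have AE_D: "AE \<omega> in M. \<forall>i. prob (D c i) = 0 \<longrightarrow> \<omega> \<notin> D c i" for c
  proof (subst AE_all_countable, intro allI)
    fix i
    show "AE \<omega> in M. prob (D c i) = 0 \<longrightarrow> \<omega> \<notin> D c i"
      using prob_eq_0[OF D_sets, of c i] by (cases "prob (D c i) = 0") auto
  qed
  \<comment> \<open>The countably many sets \<open>D K i\<close> cover the event |X| \<le>
    \<open>K\<close>, so they cannot all be null.\<close>
  obtain j where j: "prob (D K j) > 0"
  proof (rule ccontr)
    assume "\<not> thesis"
    then have z: "prob (D K i) = 0" for i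
      using that by (auto simp: zero_less_measure_iff)
    from AE_D[of K] have "AE \<omega> in M. \<omega> \<notin> {\<omega> \<in> space M. \<bar>X \<omega>\<bar> \<le> K}"
    proof eventually_elim
      case (elim \<omega>)
      then have "\<omega> \<notin> D K (g \<omega>)"
        using z by blast
      then show ?case
        by (simp add: D_def)
    qed
    then have "prob {\<omega> \<in> space M. \<bar>X \<omega>\<bar> \<le> K} = 0"
      by (subst prob_eq_0) auto
    with K show False by simp
  qed
  \<comment> \<open>Since \<open>j\<close> is fixed before \<open>c\<close>, the bound on the tail
    is a fixed positive number. Its factor 1/2 offsets the estimate |X - z| \<le> 2|X| used on the
    tail below.\<close>
  obtain c where c: "c \<ge> max K b"
    and tail: "(\<integral>x. \<bar>X x\<bar> * indicator {x. c < \<bar>X x\<bar>} x \<partial>M) < e * prob (D K j) / 2"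
    using tail_integral_small[OF X, of "e * prob (D K j) / 2" "max K b"] e j by auto
  define I where "I = {i. prob (D c i) > 0}"
  \<comment> \<open>The label \<open>j\<close> absorbs the tail and all null cells of level
    \<open>c\<close>. Hence \<open>C i\<close> is just \<open>D c i\<close> for the other
    \<open>i\<close> in \<open>I\<close>.\<close>
  define f where "f \<omega> = (if \<bar>X \<omega>\<bar> \<le> c \<and> g \<omega> \<in> I then g \<omega> else j)" for \<omega>
  have [measurable]: "f \<in> measurable M (count_space UNIV)"
    unfolding f_def by measurable
  define C where "C i = {\<omega> \<in> space M. f \<omega> = i}" for i
  have C_sets[measurable]: "C i \<in> sets M" for i
    unfolding C_def by measurable
  have DKj: "D K j \<subseteq> D c j"
    using c by (auto simp: D_def)
  have jI: "j \<in> I"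
    using j finite_measure_mono[OF DKj] by (simp add: I_def)
  have fI: "f \<omega> \<in> I" for \<omega>
    using jI by (simp add: f_def)
  have DC: "D c i \<subseteq> C i" if "i \<in> I" for i
    using that by (auto simp: D_def C_def f_def)
  have C_pos: "prob (C i) > 0" if "i \<in> I" for i
    using that finite_measure_mono[OF DC[OF that]] by (simp add: I_def)
  have D_ne: "D c i \<noteq> {}" if "i \<in> I" for i
    using that by (auto simp: I_def)
  \<comment> \<open>Truncation at \<open>c\<close> leaves only finitely many grid indices.\<close>
  have "I \<subseteq> {\<lfloor>- c / e\<rfloor>..\<lfloor>c / e\<rfloor>}"
  proof
    fix i assume "i \<in> I"
    then obtain \<omega> where "\<omega> \<in> D c i"
      using D_ne by blast
    then have "i = \<lfloor>X \<omega> / e\<rfloor>" "- c \<le> X \<omega>" "X \<omega> \<le> c"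
      by (auto simp: D_def g_def)
    then show "i \<in> {\<lfloor>- c / e\<rfloor>..\<lfloor>c / e\<rfloor>}"
      using e by (auto intro!: floor_mono divide_right_mono simp del: divide_minus_left)
  qed
  then have "finite I"
    by (rule finite_subset) simp
  define \<pi> where "\<pi> = C ` I"
  have "partition_on (space M) \<pi>"
    unfolding \<pi>_def
  proof (rule partition_onI)
    show "\<Union> (C ` I) = space M"
      using fI by (auto simp: C_def)
    show "{} \<notin> C ` I"
      using C_pos by (metis imageE measure_empty less_irrefl)
    show "disjnt p q" if "p \<in> C ` I" "q \<in> C ` I" "p \<noteq> q" for p q
      using that by (auto simp: C_def disjnt_def)
  qed
  then have \<pi>: "\<pi> \<in> finite_partitions M"
    using \<open>finite I\<close> C_pos C_sets
    by (force simp: finite_partitions_def \<pi>_def emeasure_eq_measure)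
  let ?Y = "real_cond_exp M (sigma (space M) \<pi>) X"
  let ?T = "\<lambda>x. \<bar>X x\<bar> * indicator {x. c < \<bar>X x\<bar>} x"
  have intT: "integrable M ?T"
    by (rule Bochner_Integration.integrable_bound[OF X]) (auto split: split_indicator)
  have intI: "integrable M (indicator (C i) :: 'a \<Rightarrow> real)" for i
    by (rule integrable_real_indicator) (simp_all add: emeasure_eq_measure)
  \<comment> \<open>Two points are needed: \<open>\<omega>\<close> may lie in the tail, but the
    reference point \<open>\<omega>1\<close> has |X| \<le> \<open>c\<close>. In the bulk they will
    coincide; on the tail \<open>\<omega>1\<close> will be a point of \<open>D K j\<close>.\<close>
  have mean: "\<bar>?Y \<omega> - X \<omega>1\<bar> \<le> 2 * e"
    if i: "i \<in> I" and \<omega>: "\<omega> \<in> C i" and \<omega>1: "\<omega>1 \<in> D c i" for i \<omega> \<omega>1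
  proof -
    let ?z = "X \<omega>1" and ?t = "if i = j then 2 else 0 :: real"
    have z: "\<bar>?z\<bar> \<le> c" "\<lfloor>?z / e\<rfloor> = i"
      using \<omega>1 by (auto simp: D_def g_def)
    have intC: "integrable M (\<lambda>x. indicator (C i) x * X x)"
      using integrable_mult_indicator[OF C_sets X] by simp
    have intz: "integrable M (\<lambda>x. indicator (C i) x * ?z)"
      by (intro integrable_mult_left intI)
    have int1: "integrable M (\<lambda>x. indicator (C i) x * (X x - ?z))"
      using intC intz by (simp add: right_diff_distrib)
    have "?Y \<omega> = (\<integral>x\<in>C i. X x \<partial>M) / prob (C i)"
      by (rule real_cond_exp_finite_partition[OF \<pi> X _ \<omega>]) (use i in \<open>simp add: \<pi>_def\<close>)
    then have "(?Y \<omega> - ?z) * prob (C i) = (\<integral>x\<in>C i. X x \<partial>M) - ?z * prob (C i)"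
      using C_pos[OF i] by (simp add: field_simps)
    also have "\<dots> = (\<integral>x. indicator (C i) x * (X x - ?z) \<partial>M)"
      using intC intz by (simp add: set_lebesgue_integral_def right_diff_distrib)
    finally have eq: "(?Y \<omega> - ?z) * prob (C i) = (\<integral>x. indicator (C i) x * (X x - ?z) \<partial>M)" .
    have "\<bar>?Y \<omega> - ?z\<bar> * prob (C i) = \<bar>(?Y \<omega> - ?z) * prob (C i)\<bar>"
      by (simp add: abs_mult)
    also have "\<dots> \<le> (\<integral>x. \<bar>indicator (C i) x * (X x - ?z)\<bar> \<partial>M)"
      unfolding eq by (rule integral_abs_bound)
    \<comment> \<open>Almost every bulk point of \<open>C i\<close> shares the grid interval of
      \<open>?z\<close>, giving the bound \<open>e\<close>. On the tail |\<open>?z\<close>| \<le>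
      \<open>c\<close> < |X|, giving 2|X|; this occurs only for \<open>i = j\<close>, whence
      \<open>?t\<close>.\<close>
    also have "\<dots> \<le> (\<integral>x. e * indicator (C i) x + ?t * ?T x \<partial>M)"
    proof (rule integral_mono_AE)
      show "integrable M (\<lambda>x. \<bar>indicator (C i) x * (X x - ?z)\<bar>)"
        using int1 by (rule integrable_abs)
      show "integrable M (\<lambda>x. e * indicator (C i) x + ?t * ?T x)"
        by (intro Bochner_Integration.integrable_add integrable_mult_right intI intT)
      from AE_D[of c] AE_space
      show "AE x in M. \<bar>indicator (C i) x * (X x - ?z)\<bar> \<le> e * indicator (C i) x + ?t * ?T x"
      proof eventually_elim
        case (elim x)
        show ?case
        proof (cases "x \<in> C i")
          case True
          show ?thesis
          proof (cases "\<bar>X x\<bar> \<le> c")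
            case small: True
            then have "x \<in> D c (g x)"
              using elim by (simp add: D_def)
            then have "g x \<in> I"
              using elim by (auto simp: I_def zero_less_measure_iff)
            then have "\<lfloor>X x / e\<rfloor> = \<lfloor>?z / e\<rfloor>"
              using True small z by (simp add: C_def f_def g_def)
            then have "\<bar>X x / e - ?z / e\<bar> \<le> 1"
              by linarith
            then have "\<bar>X x - ?z\<bar> \<le> e"
              using e by (simp add: diff_divide_distrib[symmetric] abs_divide)
            then show ?thesis
              using True small by simp
          next
            case False
            then have "i = j"
              using True by (auto simp: C_def f_def)
            moreover have "\<bar>X x - ?z\<bar> \<le> e + 2 * \<bar>X x\<bar>"
              using False z(1) e by linarith
            ultimately show ?thesis
              using True False by simp
          qed
        qed auto
      qed
    qed
    also have "\<dots> = e * prob (C i) + ?t * (\<integral>x. ?T x \<partial>M)"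
      by (subst Bochner_Integration.integral_add)
        (auto intro!: integrable_mult_right intI intT)
    also have "\<dots> \<le> e * prob (C i) + e * prob (C i)"
    proof (cases "i = j")
      case True
      \<comment> \<open>The choice of \<open>c\<close> was made in terms of \<open>D K j\<close>, as
        \<open>C j\<close> itself depends on \<open>c\<close>; this inclusion transfers the
        bound.\<close>
      have "prob (D K j) \<le> prob (C j)"
        using DKj DC[OF jI] by (intro finite_measure_mono) auto
      then have "e * prob (D K j) \<le> e * prob (C j)"
        using e by simp
      then show ?thesis
        using True tail by simp
    qed (use e in auto)
    finally have "\<bar>?Y \<omega> - ?z\<bar> * prob (C i) \<le> (2 * e) * prob (C i)"
      by simp
    then show ?thesis
      using C_pos[OF i] by simp
  qed
  obtain \<omega>0 where \<omega>0: "\<omega>0 \<in> D K j"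
    using j by (cases "D K j = {}") auto
  from AE_D[of c] AE_space
  have "AE \<omega> in M. (\<bar>X \<omega>\<bar> \<le> b \<longrightarrow> \<bar>?Y \<omega> - X \<omega>\<bar> \<le> 2 * e) \<and> \<bar>?Y \<omega>\<bar> \<le> \<bar>X \<omega>\<bar> + K + 2 * e"
  proof eventually_elim
    case (elim \<omega>)
    have K0: "0 \<le> K"
      using \<omega>0 by (auto simp: D_def)
    show ?case
    proof (cases "\<bar>X \<omega>\<bar> \<le> c")
      case True
      then have 1: "\<omega> \<in> D c (g \<omega>)"
        using elim by (simp add: D_def)
      then have 2: "g \<omega> \<in> I"
        using elim by (auto simp: I_def zero_less_measure_iff)
      have "\<bar>?Y \<omega> - X \<omega>\<bar> \<le> 2 * e"
        using mean[OF 2 _ 1] DC[OF 2] 1 by blast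
      then show ?thesis
        using K0 by linarith
    next
      \<comment> \<open>Closeness to \<open>X \<omega>\<close> is not claimed here, since |X| >
        \<open>c\<close> \<ge> \<open>b\<close>. Domination holds because the mean over
        \<open>C j\<close> is within \<open>2 * e\<close> of \<open>X \<omega>0\<close>, a value
        bounded by \<open>K\<close>.\<close>
      case False
      then have "\<omega> \<in> C j"
        using elim by (simp add: C_def f_def)
      then have "\<bar>?Y \<omega> - X \<omega>0\<bar> \<le> 2 * e"
        using mean[OF jI] \<omega>0 DKj by blast
      moreover have "\<bar>X \<omega>0\<bar> \<le> K"
        using \<omega>0 by (simp add: D_def)
      ultimately show ?thesis
        using False c by linarith
    qed
  qed
  with \<pi> show ?thesis by blast
qed

text \<open>The events |X| \<le> n cover the whole space, so they are not all null.\<close>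

lemma ex_bounded_with_positive_prob:
  fixes X :: "'a \<Rightarrow> real"
  assumes [measurable]: "X \<in> borel_measurable M"
  shows "\<exists>K\<ge>0. prob {\<omega> \<in> space M. \<bar>X \<omega>\<bar> \<le> K} > 0"
proof (rule ccontr)
  assume "\<not> ?thesis"
  then have "prob {\<omega> \<in> space M. \<bar>X \<omega>\<bar> \<le> real n} = 0" for n
    by (auto simp: zero_less_measure_iff)
  then have "AE \<omega> in M. \<forall>n. \<not> \<bar>X \<omega>\<bar> \<le> real n"
    by (subst AE_all_countable) (auto simp: prob_eq_0)
  then have "AE \<omega> in M. False"
    by eventually_elim (meson real_arch_simple)
  then show False
    by simp
qed

end

theorem lemma2:
  fixes M :: "'a measure" and X :: "'a \<Rightarrow> real"
  assumes "prob_space M"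
    and "nonatomic M"
    and "integrable M X"
  shows "\<exists>(\<pi> :: nat \<Rightarrow> 'a set set) (k :: real).
           (\<forall>n. \<pi> n \<in> finite_partitions M) \<and> k \<ge> 0 \<and>
           (AE \<omega> in M. (\<lambda>n. real_cond_exp M (sigma (space M) (\<pi> n)) X \<omega>) \<longlonglongrightarrow> X \<omega>) \<and>
           (\<forall>n. AE \<omega> in M. \<bar>real_cond_exp M (sigma (space M) (\<pi> n)) X \<omega>\<bar> \<le> \<bar>X \<omega>\<bar> + k)"
proof -
  interpret prob_space M by fact
  let ?Y = "\<lambda>P. real_cond_exp M (sigma (space M) P) X"
  obtain K where K: "K \<ge> 0" "prob {\<omega> \<in> space M. \<bar>X \<omega>\<bar> \<le> K} > 0"
    using ex_bounded_with_positive_prob[of X] assms(3) by auto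
  \<comment> \<open>\<open>e n\<close> tends to 0 for the convergence, and \<open>e n\<close> \<le>
    1 makes \<open>k = K + 2\<close> work for every n.\<close>
  define e :: "nat \<Rightarrow> real" where "e n = 1 / real (Suc n)" for n
  have e: "0 < e n" "e n \<le> 1" for n
    by (auto simp: e_def)
  have "\<forall>n. \<exists>P\<in>finite_partitions M.
    AE \<omega> in M. (\<bar>X \<omega>\<bar> \<le> real n \<longrightarrow> \<bar>?Y P \<omega> - X \<omega>\<bar> \<le> 2 * e n) \<and> \<bar>?Y P \<omega>\<bar> \<le> \<bar>X \<omega>\<bar> + K + 2 * e n"
    using finite_partition_approx[OF assms(3) e(1) K(2)] by blast
  from choice[OF this[unfolded Bex_def]] obtain \<pi> where \<pi>: "\<And>n. \<pi> n \<in> finite_partitions M"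
    and AE_\<pi>: "\<And>n. AE \<omega> in M. (\<bar>X \<omega>\<bar> \<le> real n \<longrightarrow> \<bar>?Y (\<pi> n) \<omega> - X \<omega>\<bar> \<le> 2 * e n) \<and>
        \<bar>?Y (\<pi> n) \<omega>\<bar> \<le> \<bar>X \<omega>\<bar> + K + 2 * e n"
    by blast
  have "AE \<omega> in M. \<forall>n. \<bar>X \<omega>\<bar> \<le> real n \<longrightarrow> \<bar>?Y (\<pi> n) \<omega> - X \<omega>\<bar> \<le> 2 * e n"
    using AE_\<pi> by (subst AE_all_countable) auto
  then have conv: "AE \<omega> in M. (\<lambda>n. ?Y (\<pi> n) \<omega>) \<longlonglongrightarrow> X \<omega>"
  proof eventually_elim
    case (elim \<omega>)
    \<comment> \<open>The truncation level n eventually exceeds |X| at any given point, so the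
      approximation estimate applies from then on.\<close>
    have "\<forall>\<^sub>F n in sequentially. \<bar>X \<omega>\<bar> \<le> real n"
      by (rule eventually_sequentiallyI[of "nat \<lceil>\<bar>X \<omega>\<bar>\<rceil>"]) linarith
    then have "\<forall>\<^sub>F n in sequentially. norm (?Y (\<pi> n) \<omega> - X \<omega>) \<le> 2 * e n"
      by eventually_elim (use elim in auto)
    moreover have "(\<lambda>n. 2 * e n) \<longlonglongrightarrow> 0"
      using tendsto_mult_right_zero[OF LIMSEQ_inverse_real_of_nat]
      by (simp add: e_def inverse_eq_divide)
    ultimately have "(\<lambda>n. ?Y (\<pi> n) \<omega> - X \<omega>) \<longlonglongrightarrow> 0"
      by (rule Lim_null_comparison)
    then show ?case
      by (simp add: LIM_zero_iff)
  qed
  have bound: "AE \<omega> in M. \<bar>?Y (\<pi> n) \<omega>\<bar> \<le> \<bar>X \<omega>\<bar> + (K + 2)" for n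
    using AE_\<pi>[of n]
  proof eventually_elim
    case (elim \<omega>)
    then show ?case
      using e(2)[of n] by linarith
  qed
  have "0 \<le> K + 2"
    using K(1) by simp
  with \<pi> conv bound show ?thesis by blast
qed

end
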